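(* Let $r\ge 2$, $d\ge 1$ be integers, $n=(r-1)(d+1)+1$, and let $A\subset\mathbb{R}^d$ be a set of $n$ points whose $dn$ coordinates are algebraically independent. Let $M\subset A$ with $|M|\le r-1$ and $\operatorname{conv} M\cap \operatorname{conv}(A\setminus M)=\emptyset$. Then there is a partition $\{A_1,\ldots,A_r\}$ of $A$ and a solution $(z,\alpha)$, $z\in\mathbb{R}^d$, $\alpha:A\to\mathbb{R}$, of the system \[ z=\sum_{x\in A_j}\alpha(x)\,x \quad\text{and}\quad 1=\sum_{x\in A_j}\alpha(x)\qquad\text{for all } j\in[r], \] such that $\alpha(x)<0$ if and only if $x\in M$.
   Context: $[r]=\{1,\ldots,r\}$; $\operatorname{conv}$ denotes convex hull, and $\operatorname{conv}\emptyset=\emptyset$. The condition on $M$ means that $M$ and $A\setminus M$ can be separated by a hyperplane. *)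

theory Defs
  imports "HOL-Analysis.Analysis" "HOL-Library.Poly_Mapping"
begin

definition mpoly_eval :: "(('i \<Rightarrow>\<^sub>0 nat) \<Rightarrow>\<^sub>0 rat) \<Rightarrow> ('i \<Rightarrow> real) \<Rightarrow> real" where
  "mpoly_eval p c = (\<Sum>(mon :: 'i \<Rightarrow>\<^sub>0 nat)\<in>Poly_Mapping.keys p. of_rat (Poly_Mapping.lookup p mon) * (\<Prod>v\<in>Poly_Mapping.keys mon. c v ^ Poly_Mapping.lookup mon v))"

definition alg_indep_on :: "'i set \<Rightarrow> ('i \<Rightarrow> real) \<Rightarrow> bool" where
  "alg_indep_on I c \<longleftrightarrow>
     (\<forall>p :: ('i \<Rightarrow>\<^sub>0 nat) \<Rightarrow>\<^sub>0 rat. (\<forall>m\<in>Poly_Mapping.keys p. Poly_Mapping.keys m \<subseteq> I) \<longrightarrow> mpoly_eval p c = 0 \<longrightarrow> p = 0)"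

end

theory Submission
  imports Defs "Jordan_Normal_Form.Determinant"
begin

text \<open>
  Sarkaria's trick turns a partition of \<open>A\<close> with a common affine point into a linear dependence
  among tensors \<open>(x, 1) \<otimes> v\<^sub>j\<close>, where \<open>v\<^sub>1, \<dots>, v\<^sub>r\<close> span \<open>\<real>\<^bsup>r - 1\<^esup>\<close> and have sum zero. Negating the tensors of
  the points of \<open>M\<close> and applying the colorful Caratheodory theorem gives coefficients that are
  nonpositive on \<open>M\<close> and nonnegative elsewhere. Since \<open>M\<close> has fewer than \<open>r\<close> points, some block
  avoids \<open>M\<close>, and together with the separation of \<open>M\<close> from \<open>A - M\<close> this makes the common block sum
  positive. In a solution of minimal support no block has more than \<open>d + 1\<close> points of the support.
  If the support were a proper subset of \<open>A\<close>, the Gram determinant of its tensors would be a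
  polynomial in the coordinates which vanishes at \<open>A\<close>, but not at a suitable configuration of
  vertices of the standard simplex, contradicting algebraic independence.
\<close>

no_notation vec_index (infixl "$" 100)
no_notation scalar_prod (infix "\<bullet>" 70)

section \<open>Polynomial functions of algebraically independent numbers\<close>

definition monomial_eval :: "('i \<Rightarrow>\<^sub>0 nat) \<Rightarrow> ('i \<Rightarrow> real) \<Rightarrow> real" where
  "monomial_eval m c = (\<Prod>v\<in>Poly_Mapping.keys m. c v ^ Poly_Mapping.lookup m v)"

lemma monomial_eval_superset:
  assumes "finite V" "Poly_Mapping.keys m \<subseteq> V"
  shows "monomial_eval m c = (\<Prod>v\<in>V. c v ^ Poly_Mapping.lookup m v)"
  unfolding monomial_eval_def
  by (rule prod.mono_neutral_left) (use assms in \<open>auto simp: in_keys_iff\<close>)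

lemma monomial_eval_0: "monomial_eval 0 c = 1"
  by (simp add: monomial_eval_def)

lemma monomial_eval_single: "monomial_eval (Poly_Mapping.single v 1) c = c v"
  by (simp add: monomial_eval_def)

lemma monomial_eval_add: "monomial_eval (m + m') c = monomial_eval m c * monomial_eval m' c"
proof -
  let ?V = "Poly_Mapping.keys m \<union> Poly_Mapping.keys m'"
  have "monomial_eval (m + m') c = (\<Prod>v\<in>?V. c v ^ Poly_Mapping.lookup (m + m') v)"
    by (intro monomial_eval_superset) (auto simp: keys_add)
  also have "\<dots> = (\<Prod>v\<in>?V. c v ^ Poly_Mapping.lookup m v) * (\<Prod>v\<in>?V. c v ^ Poly_Mapping.lookup m' v)"
    by (simp add: lookup_add power_add prod.distrib)
  also have "\<dots> = monomial_eval m c * monomial_eval m' c"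
    by (simp add: monomial_eval_superset[of ?V])
  finally show ?thesis .
qed

lemma mpoly_eval_superset:
  assumes "finite S" "Poly_Mapping.keys p \<subseteq> S"
  shows "mpoly_eval p c = (\<Sum>m\<in>S. of_rat (Poly_Mapping.lookup p m) * monomial_eval m c)"
  unfolding mpoly_eval_def monomial_eval_def
  by (rule sum.mono_neutral_left) (use assms in \<open>auto simp: in_keys_iff\<close>)

lemma mpoly_eval_0: "mpoly_eval 0 c = 0"
  by (simp add: mpoly_eval_def)

lemma mpoly_eval_add: "mpoly_eval (p + q) c = mpoly_eval p c + mpoly_eval q c"
proof -
  let ?S = "Poly_Mapping.keys p \<union> Poly_Mapping.keys q"
  have "mpoly_eval (p + q) c
      = (\<Sum>m\<in>?S. of_rat (Poly_Mapping.lookup (p + q) m) * monomial_eval m c)"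
    using keys_add[of p q] by (intro mpoly_eval_superset) auto
  also have "\<dots> = mpoly_eval p c + mpoly_eval q c"
    by (simp add: mpoly_eval_superset[of ?S] lookup_add of_rat_add algebra_simps sum.distrib)
  finally show ?thesis .
qed

text \<open>The representing \<open>p\<close> has rational coefficients and indeterminates in
  \<open>I\<close>, as in \<open>alg_indep_on\<close>. Closure rules for this predicate make it
  possible to treat the Gram determinant without writing down its formal polynomial.\<close>

definition polynomial_fun :: "'i set \<Rightarrow> (('i \<Rightarrow> real) \<Rightarrow> real) \<Rightarrow> bool" where
  "polynomial_fun I f \<longleftrightarrow>
     (\<exists>p. (\<forall>m\<in>Poly_Mapping.keys p. Poly_Mapping.keys m \<subseteq> I) \<and> (\<forall>c. mpoly_eval p c = f c))"

lemma polynomial_fun_add: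
  assumes "polynomial_fun I f" "polynomial_fun I g"
  shows "polynomial_fun I (\<lambda>c. f c + g c)"
proof -
  obtain p q where "\<forall>m\<in>Poly_Mapping.keys p. Poly_Mapping.keys m \<subseteq> I" "\<forall>c. mpoly_eval p c = f c"
    "\<forall>m\<in>Poly_Mapping.keys q. Poly_Mapping.keys m \<subseteq> I" "\<forall>c. mpoly_eval q c = g c"
    using assms unfolding polynomial_fun_def by blast
  then show ?thesis
    unfolding polynomial_fun_def using keys_add[of p q]
    by (intro exI[of _ "p + q"]) (auto simp: mpoly_eval_add dest!: subsetD)
qed

lemma polynomial_fun_0: "polynomial_fun I (\<lambda>c. 0)"
  unfolding polynomial_fun_def by (intro exI[of _ 0]) (auto simp: mpoly_eval_0)

lemma polynomial_fun_sum:
  assumes "\<And>s. s \<in> S \<Longrightarrow> polynomial_fun I (f s)"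
  shows "polynomial_fun I (\<lambda>c. \<Sum>s\<in>S. f s c)"
  using assms
  by (induction S rule: infinite_finite_induct) (auto simp: polynomial_fun_0 intro: polynomial_fun_add)

lemma polynomial_fun_monomial:
  assumes "Poly_Mapping.keys m \<subseteq> I"
  shows "polynomial_fun I (\<lambda>c. of_rat a * monomial_eval m c)"
  unfolding polynomial_fun_def
  by (intro exI[of _ "Poly_Mapping.single m a"])
    (use assms in \<open>auto simp: mpoly_eval_superset[of "{m}"] split: if_splits\<close>)

lemma polynomial_fun_of_rat: "polynomial_fun I (\<lambda>c. of_rat a)"
  using polynomial_fun_monomial[of 0 I a] by (simp add: monomial_eval_0)

lemma polynomial_fun_of_int: "polynomial_fun I (\<lambda>c. of_int a)"
  using polynomial_fun_of_rat[of I "of_int a"] by simp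

lemma polynomial_fun_var: "v \<in> I \<Longrightarrow> polynomial_fun I (\<lambda>c. c v)"
  using polynomial_fun_monomial[of "Poly_Mapping.single v 1" I 1]
  by (simp add: monomial_eval_single[simplified])

text \<open>Expanding the product of the two evaluations into monomials \<open>m + m'\<close>
  reduces the claim to sums of monomial functions.\<close>

lemma polynomial_fun_mult:
  assumes "polynomial_fun I f" "polynomial_fun I g"
  shows "polynomial_fun I (\<lambda>c. f c * g c)"
proof -
  obtain p q where p: "\<forall>m\<in>Poly_Mapping.keys p. Poly_Mapping.keys m \<subseteq> I" "\<forall>c. mpoly_eval p c = f c"
    and q: "\<forall>m\<in>Poly_Mapping.keys q. Poly_Mapping.keys m \<subseteq> I" "\<forall>c. mpoly_eval q c = g c"
    using assms unfolding polynomial_fun_def by blast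
  have "f c * g c = (\<Sum>m\<in>Poly_Mapping.keys p. \<Sum>m'\<in>Poly_Mapping.keys q.
      of_rat (Poly_Mapping.lookup p m * Poly_Mapping.lookup q m') * monomial_eval (m + m') c)" for c
  proof -
    have "f c * g c = mpoly_eval p c * mpoly_eval q c" using p q by simp
    also have "\<dots> = (\<Sum>m\<in>Poly_Mapping.keys p. \<Sum>m'\<in>Poly_Mapping.keys q.
      (of_rat (Poly_Mapping.lookup p m) * monomial_eval m c) * (of_rat (Poly_Mapping.lookup q m') * monomial_eval m' c))"
      by (simp add: mpoly_eval_superset[OF _ order_refl] sum_product)
    finally show ?thesis by (simp add: monomial_eval_add of_rat_mult ac_simps)
  qed
  moreover have "polynomial_fun I (\<lambda>c. \<Sum>m\<in>Poly_Mapping.keys p. \<Sum>m'\<in>Poly_Mapping.keys q.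
      of_rat (Poly_Mapping.lookup p m * Poly_Mapping.lookup q m') * monomial_eval (m + m') c)"
    using p(1) q(1)
    by (intro polynomial_fun_sum polynomial_fun_monomial order_trans[OF keys_add]) auto
  ultimately show ?thesis by simp
qed

lemma polynomial_fun_prod:
  assumes "\<And>s. s \<in> S \<Longrightarrow> polynomial_fun I (f s)"
  shows "polynomial_fun I (\<lambda>c. \<Prod>s\<in>S. f s c)"
  using assms polynomial_fun_of_int[of I 1]
  by (induction S rule: infinite_finite_induct) (auto intro: polynomial_fun_mult)

text \<open>By the Leibniz formula the determinant is an integer combination of products of
  entries.\<close>

lemma polynomial_fun_det:
  assumes "\<And>i j. i < n \<Longrightarrow> j < n \<Longrightarrow> polynomial_fun I (\<lambda>c. G c i j)"
  shows "polynomial_fun I (\<lambda>c. det (mat n n (\<lambda>(i, j). G c i j)))"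
proof -
  have "det (mat n n (\<lambda>(i, j). G c i j))
     = (\<Sum>p\<in>{p. p permutes {0..<n}}. of_int (sign p) * (\<Prod>i = 0..<n. G c i (p i)))" for c
    by (subst det_def'[of _ n]) (auto intro!: sum.cong prod.cong dest: permutes_in_image)
  moreover have "polynomial_fun I (\<lambda>c. \<Sum>p\<in>{p. p permutes {0..<n}}. of_int (sign p) * (\<Prod>i = 0..<n. G c i (p i)))"
    by (intro polynomial_fun_sum polynomial_fun_mult polynomial_fun_prod polynomial_fun_of_int assms)
      (auto dest: permutes_in_image)
  ultimately show ?thesis by simp
qed

text \<open>A nonzero value at one assignment \<open>c'\<close>, however special, shows that the
  formal polynomial is not zero; algebraic independence then forbids a zero at
  \<open>c\<close>.\<close>

lemma alg_indep_on_polynomial_fun_nonzero: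
  assumes "alg_indep_on I c" "polynomial_fun I f" "f c' \<noteq> 0"
  shows "f c \<noteq> 0"
proof
  assume "f c = 0"
  obtain p where "\<forall>m\<in>Poly_Mapping.keys p. Poly_Mapping.keys m \<subseteq> I" "\<forall>c. mpoly_eval p c = f c"
    using assms(2) unfolding polynomial_fun_def by blast
  with \<open>f c = 0\<close> assms(1) have "p = 0" unfolding alg_indep_on_def by metis
  with \<open>\<forall>c. mpoly_eval p c = f c\<close> assms(3) show False by (metis mpoly_eval_0)
qed

text \<open>A square matrix is singular exactly when its kernel is nontrivial. Matrices are indexed
  by numbers, so the enumeration \<open>h\<close> carries kernel vectors to functions on
  \<open>T\<close> and back.\<close>

lemma det_ne_0_iff_kernel_trivial:
  fixes G :: "'i \<Rightarrow> 'i \<Rightarrow> real"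
  assumes "bij_betw h {0..<n} T"
  shows "det (mat n n (\<lambda>(i, j). G (h i) (h j))) \<noteq> 0 \<longleftrightarrow>
    (\<forall>\<mu>. (\<forall>x\<in>T. (\<Sum>y\<in>T. G x y * \<mu> y) = 0) \<longrightarrow> (\<forall>x\<in>T. \<mu> x = 0))"
proof -
  let ?A = "mat n n (\<lambda>(i, j). G (h i) (h j))"
  have A: "?A \<in> carrier_mat n n" by simp
  have T: "T = h ` {0..<n}" and inj: "inj_on h {0..<n}"
    using assms by (auto simp: bij_betw_def)
  have mult: "vec_index (?A *\<^sub>v v) i = (\<Sum>j = 0..<n. G (h i) (h j) * vec_index v j)"
    if "i < n" "v \<in> carrier_vec n" for i v
    using that by (simp add: scalar_prod_def)
  have reindex: "(\<Sum>y\<in>T. G x y * \<mu> y) = (\<Sum>j = 0..<n. G x (h j) * \<mu> (h j))" for x \<mu>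
    unfolding T by (simp add: sum.reindex[OF inj])
  show ?thesis
  proof (intro iffI allI impI notI)
    fix \<mu>
    assume "det ?A \<noteq> 0" and \<mu>: "\<forall>x\<in>T. (\<Sum>y\<in>T. G x y * \<mu> y) = 0"
    define v where "v = vec n (\<lambda>j. \<mu> (h j))"
    have "?A *\<^sub>v v = 0\<^sub>v n"
    proof (rule eq_vecI)
      fix i assume "i < dim_vec (0\<^sub>v n :: real Matrix.vec)"
      then show "vec_index (?A *\<^sub>v v) i = vec_index (0\<^sub>v n) i"
        using \<mu> by (subst mult) (auto simp: v_def reindex simp flip: T, auto simp: T)
    qed simp
    then have "v = 0\<^sub>v n"
      using \<open>det ?A \<noteq> 0\<close> det_0_iff_vec_prod_zero_field[OF A] vec_carrier unfolding v_def by blast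
    then have "vec_index v j = 0" if "j < n" for j using that by simp
    then show "\<forall>x\<in>T. \<mu> x = 0" by (auto simp: T v_def)
  next
    assume *: "\<forall>\<mu>. (\<forall>x\<in>T. (\<Sum>y\<in>T. G x y * \<mu> y) = 0) \<longrightarrow> (\<forall>x\<in>T. \<mu> x = 0)"
      and "det ?A = 0"
    then obtain v where v: "v \<in> carrier_vec n" "v \<noteq> 0\<^sub>v n" "?A *\<^sub>v v = 0\<^sub>v n"
      using det_0_iff_vec_prod_zero_field[OF A] by auto
    define \<mu> where "\<mu> = (\<lambda>x. vec_index v (inv_into {0..<n} h x))"
    have \<mu>: "\<mu> (h j) = vec_index v j" if "j < n" for j
      using that inj by (simp add: \<mu>_def)
    have "(\<Sum>y\<in>T. G x y * \<mu> y) = 0" if "x \<in> T" for x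
    proof -
      from that obtain i where i: "i < n" "x = h i" by (auto simp: T)
      have "(\<Sum>y\<in>T. G x y * \<mu> y) = vec_index (?A *\<^sub>v v) i"
        using i v(1) by (subst mult) (auto simp: reindex \<mu>)
      then show ?thesis using i v(3) by simp
    qed
    then have "\<forall>x\<in>T. \<mu> x = 0" using * by blast
    then have "v = 0\<^sub>v n"
      using v(1) by (intro eq_vecI) (auto simp: T \<mu>)
    with v(2) show False ..
  qed
qed

section \<open>Colorful Caratheodory theorem\<close>

text \<open>Ratio test: the step grows until the first coordinate reaches zero. Since
  \<open>\<mu>\<close> vanishes where \<open>\<beta>\<close> does, that coordinate was nonzero
  before and the support really shrinks.\<close>

lemma subtract_to_boundary:
  fixes \<beta> \<mu> :: "'i \<Rightarrow> real"
  assumes "finite I" "\<And>i. i \<in> I \<Longrightarrow> 0 \<le> \<beta> i"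
    and "\<And>i. i \<in> I \<Longrightarrow> \<mu> i \<noteq> 0 \<Longrightarrow> \<beta> i \<noteq> 0" and "\<exists>i\<in>I. \<mu> i \<noteq> 0"
  shows "\<exists>s. (\<forall>i\<in>I. 0 \<le> \<beta> i - s * \<mu> i) \<and> (\<exists>i\<in>I. \<beta> i \<noteq> 0 \<and> \<beta> i - s * \<mu> i = 0)"
proof -
  have main: "\<exists>s. (\<forall>i\<in>I. 0 \<le> \<beta> i - s * \<mu> i) \<and> (\<exists>i\<in>I. \<beta> i \<noteq> 0 \<and> \<beta> i - s * \<mu> i = 0)"
    if supp: "\<And>i. i \<in> I \<Longrightarrow> \<mu> i \<noteq> 0 \<Longrightarrow> \<beta> i \<noteq> 0" and pos: "\<exists>i\<in>I. \<mu> i > 0" for \<mu> :: "'i \<Rightarrow> real"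
  proof -
    let ?P = "{i\<in>I. \<mu> i > 0}"
    have P: "finite ?P" "?P \<noteq> {}" using assms(1) pos by auto
    \<comment> \<open>The smallest ratio is the largest step that keeps all coordinates with
      \<open>\<mu> i > 0\<close> nonnegative; the other coordinates do not decrease.\<close>
    define i0 where "i0 = arg_min_on (\<lambda>i. \<beta> i / \<mu> i) ?P"
    have i0: "i0 \<in> ?P" unfolding i0_def by (rule arg_min_if_finite[OF P])
    have le: "\<beta> i0 / \<mu> i0 \<le> \<beta> i / \<mu> i" if "i \<in> ?P" for i
      using arg_min_least[OF P that, of "\<lambda>i. \<beta> i / \<mu> i"] by (simp add: i0_def)
    have s: "\<beta> i0 / \<mu> i0 \<ge> 0" using i0 assms(2) by simp
    have "0 \<le> \<beta> i - \<beta> i0 / \<mu> i0 * \<mu> i" if "i \<in> I" for i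
    proof (cases "\<mu> i > 0")
      case True
      then show ?thesis using le[of i] that by (simp add: field_simps)
    next
      case False
      then have "\<beta> i0 / \<mu> i0 * \<mu> i \<le> 0" using mult_nonneg_nonpos[OF s, of "\<mu> i"] by simp
      then show ?thesis using assms(2)[OF that] by linarith
    qed
    moreover have "\<beta> i0 \<noteq> 0" using i0 supp by auto
    ultimately show ?thesis using i0 by (intro exI[of _ "\<beta> i0 / \<mu> i0"]) auto
  qed
  show ?thesis
  proof (cases "\<exists>i\<in>I. \<mu> i > 0")
    case True
    with assms(3) show ?thesis by (rule main)
  next
    case False
    with assms(4) have "\<exists>i\<in>I. - \<mu> i > 0" by force
    then obtain s where "\<forall>i\<in>I. 0 \<le> \<beta> i - s * - \<mu> i" "\<exists>i\<in>I. \<beta> i \<noteq> 0 \<and> \<beta> i - s * - \<mu> i = 0"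
      using main[of "\<lambda>i. - \<mu> i"] assms(3) by auto
    then show ?thesis by (intro exI[of _ "- s"]) auto
  qed
qed

text \<open>The statement is about families because selected vectors may coincide. Two equal members
  give the coefficients 1 and -1; an injective family is too large to be independent inside
  \<open>span B\<close>.\<close>

lemma family_dependent:
  fixes u :: "'i \<Rightarrow> 'v::real_vector"
  assumes "finite B" "\<And>i. i \<in> I \<Longrightarrow> u i \<in> span B" "card B < card I"
  obtains \<mu> where "(\<Sum>i\<in>I. \<mu> i *\<^sub>R u i) = 0" "\<exists>i\<in>I. \<mu> i \<noteq> 0"
proof (cases "inj_on u I")
  case True
  have finI: "finite I" using assms(3) by (intro card_ge_0_finite) linarith
  have "\<not> independent (u ` I)"
  proof
    assume "independent (u ` I)"
    then have "card (u ` I) \<le> card B"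
      using independent_span_bound[OF assms(1)] assms(2) by blast
    then show False using assms(3) True by (simp add: card_image)
  qed
  then obtain g where g: "(\<Sum>v\<in>u ` I. g v *\<^sub>R v) = 0" "\<exists>v\<in>u ` I. g v \<noteq> 0"
    using finI dependent_finite[of "u ` I"] by auto
  show ?thesis
    by (rule that[of "g \<circ> u"]) (use g in \<open>auto simp: sum.reindex[OF True]\<close>)
next
  case False
  then obtain a b where ab: "a \<in> I" "b \<in> I" "a \<noteq> b" "u a = u b" by (auto simp: inj_on_def)
  have finI: "finite I" using assms(3) by (intro card_ge_0_finite) linarith
  let ?\<mu> = "\<lambda>i. if i = a then 1 else if i = b then -1 else (0::real)"
  have "(\<Sum>i\<in>I. ?\<mu> i *\<^sub>R u i) = (\<Sum>i\<in>{a,b}. ?\<mu> i *\<^sub>R u i)"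
    by (rule sum.mono_neutral_right) (use finI ab in auto)
  also have "\<dots> = 0" using ab by simp
  finally show ?thesis using ab by (intro that[of ?\<mu>]) auto
qed

text \<open>A hull point has coefficients on the values of \<open>f\<close>; each is placed on one
  chosen preimage, and all other indices get 0.\<close>

lemma convex_hull_image_coefficients:
  fixes f :: "'i \<Rightarrow> 'v::real_vector"
  assumes "finite I" "p \<in> convex hull (f ` I)"
  obtains c where "\<And>i. i \<in> I \<Longrightarrow> 0 \<le> c i" "sum c I = 1" "(\<Sum>i\<in>I. c i *\<^sub>R f i) = p"
proof -
  obtain u where u: "\<forall>x\<in>f ` I. 0 \<le> u x" "sum u (f ` I) = 1" "(\<Sum>x\<in>f ` I. u x *\<^sub>R x) = p"
    using assms by (auto simp: convex_hull_finite)
  define J where "J = inv_into I f ` f ` I"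
  have J: "J \<subseteq> I" by (auto simp: J_def inv_into_into)
  have inj: "inj_on (inv_into I f) (f ` I)" by (simp add: inj_on_inv_into)
  have f: "f (inv_into I f x) = x" if "x \<in> f ` I" for x using that by (rule f_inv_into_f)
  let ?c = "\<lambda>i. if i \<in> J then u (f i) else 0"
  have IJ: "I \<inter> J = J" using J by blast
  show ?thesis
  proof (rule that[of ?c])
    have "sum ?c I = (\<Sum>i\<in>J. u (f i))"
      by (simp add: sum.inter_restrict[OF assms(1), symmetric] IJ)
    also have "\<dots> = sum u (f ` I)"
      unfolding J_def by (subst sum.reindex[OF inj]) (auto intro!: sum.cong simp: f)
    finally show "sum ?c I = 1" using u by simp
    have "(\<Sum>i\<in>I. ?c i *\<^sub>R f i) = (\<Sum>i\<in>I. if i \<in> J then u (f i) *\<^sub>R f i else 0)"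
      by (rule sum.cong) auto
    also have "\<dots> = (\<Sum>i\<in>J. u (f i) *\<^sub>R f i)"
      by (simp add: sum.inter_restrict[OF assms(1), symmetric] IJ)
    also have "\<dots> = (\<Sum>x\<in>f ` I. u x *\<^sub>R x)"
      unfolding J_def by (subst sum.reindex[OF inj]) (auto intro!: sum.cong simp: f)
    finally show "(\<Sum>i\<in>I. ?c i *\<^sub>R f i) = p" using u by simp
  qed (use u J in auto)
qed

text \<open>Barany's argument. Color \<open>i\<close> offers the vectors \<open>u i j\<close>, whose
  zero sum puts the origin in their convex hull. Among the hulls of all transversals take the point
  \<open>p\<close> nearest to the origin. If \<open>p\<close> were nonzero, a vector of weight 0
  could be exchanged for one of the same color with nonpositive product with \<open>p\<close>, and
  the new hull would come nearer.\<close>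

theorem colorful_caratheodory:
  fixes u :: "'i \<Rightarrow> 'c \<Rightarrow> 'v::real_inner"
  assumes "finite I" "finite J" "J \<noteq> {}" "finite B" "card B < card I"
    and "\<And>i j. i \<in> I \<Longrightarrow> j \<in> J \<Longrightarrow> u i j \<in> span B"
    and "\<And>i. i \<in> I \<Longrightarrow> (\<Sum>j\<in>J. u i j) = 0"
  obtains \<sigma> \<beta> where "\<And>i. i \<in> I \<Longrightarrow> \<sigma> i \<in> J" "\<And>i. i \<in> I \<Longrightarrow> 0 \<le> \<beta> i" "sum \<beta> I = 1"
    "(\<Sum>i\<in>I. \<beta> i *\<^sub>R u i (\<sigma> i)) = 0"
proof -
  define H where "H = (\<lambda>\<sigma>. convex hull ((\<lambda>i. u i (\<sigma> i)) ` I))"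
  let ?F = "I \<rightarrow>\<^sub>E J"
  let ?S = "\<Union>\<sigma>\<in>?F. H \<sigma>"
  have "I \<noteq> {}" using assms(5) by auto
  have "finite ?F" using assms(1,2) by (rule finite_PiE)
  then have "compact ?S"
    unfolding H_def by (intro compact_UN finite_imp_compact_convex_hull finite_imageI assms)
  moreover have "?F \<noteq> {}" using assms(3) by (simp add: PiE_eq_empty_iff)
  then have "?S \<noteq> {}" using \<open>I \<noteq> {}\<close> by (auto simp: H_def)
  ultimately have "\<exists>p\<in>?S. \<forall>q\<in>?S. norm p \<le> norm q"
    by (rule continuous_attains_inf) (rule continuous_on_norm_id)
  then obtain p where p: "p \<in> ?S" "\<And>q. q \<in> ?S \<Longrightarrow> norm p \<le> norm q" by blast
  then obtain \<sigma> where \<sigma>: "\<sigma> \<in> ?F" "p \<in> H \<sigma>" by blast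
  let ?w = "\<lambda>i. u i (\<sigma> i)"
  have \<sigma>J: "\<sigma> i \<in> J" if "i \<in> I" for i using \<sigma> that by auto
  \<comment> \<open>First-order condition for \<open>p\<close> as the point of a convex hull nearest
    to 0.\<close>
  have closest: "p \<bullet> p \<le> p \<bullet> q" if "\<tau> \<in> ?F" "p \<in> H \<tau>" "q \<in> H \<tau>" for \<tau> q
  proof -
    have "(0 - p) \<bullet> (q - p) \<le> 0"
      by (rule any_closest_point_dot[of "H \<tau>"])
        (use that p(2) in \<open>auto simp: H_def intro!: compact_imp_closed finite_imp_compact_convex_hull assms\<close>)
    then show ?thesis by (simp add: algebra_simps)
  qed
  obtain c where c: "\<And>i. i \<in> I \<Longrightarrow> 0 \<le> c i" "sum c I = 1" "(\<Sum>i\<in>I. c i *\<^sub>R ?w i) = p"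
    using convex_hull_image_coefficients[OF assms(1) \<sigma>(2)[unfolded H_def]] by blast
  have "p = 0"
  proof (rule ccontr)
    assume "p \<noteq> 0"
    then have pp: "p \<bullet> p > 0" by simp
    have ge: "p \<bullet> p \<le> p \<bullet> ?w i" if "i \<in> I" for i
      using \<sigma> that by (intro closest[of \<sigma>]) (auto simp: H_def hull_inc)
    \<comment> \<open>The convex combination of the nonnegative excesses over
      \<open>p \<bullet> p\<close> is zero, so each summand vanishes.\<close>
    have "(\<Sum>i\<in>I. c i * (p \<bullet> ?w i - p \<bullet> p)) = p \<bullet> (\<Sum>i\<in>I. c i *\<^sub>R ?w i) - sum c I * (p \<bullet> p)"
      by (simp add: inner_sum_right right_diff_distrib sum_subtractf sum_distrib_right)
    then have "(\<Sum>i\<in>I. c i * (p \<bullet> ?w i - p \<bullet> p)) = 0" by (simp add: c)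
    then have face: "c i * (p \<bullet> ?w i - p \<bullet> p) = 0" if "i \<in> I" for i
      using that by (subst (asm) sum_nonneg_eq_0_iff) (use ge c(1) assms(1) in auto)
    \<comment> \<open>All generators in use lie on the hyperplane through \<open>p\<close> orthogonal to \<open>p\<close>, which misses the
      origin; hence linear dependence is affine dependence and one color can be freed.\<close>
    have "\<exists>c' i0. (\<forall>i\<in>I. 0 \<le> c' i) \<and> sum c' I = 1 \<and> (\<Sum>i\<in>I. c' i *\<^sub>R ?w i) = p \<and> i0 \<in> I \<and> c' i0 = 0"
    proof (cases "\<exists>i\<in>I. c i = 0")
      case True
      then show ?thesis using c by blast
    next
      case False
      obtain \<mu> where \<mu>: "(\<Sum>i\<in>I. \<mu> i *\<^sub>R ?w i) = 0" "\<exists>i\<in>I. \<mu> i \<noteq> 0"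
        using family_dependent[of B I ?w] assms \<sigma>J by blast
      \<comment> \<open>Pairing with \<open>p\<close> gives \<open>sum \<mu> I = 0\<close>, so
        moving along \<open>\<mu>\<close> keeps the total weight as well as the point
        \<open>p\<close>.\<close>
      have "0 = p \<bullet> (\<Sum>i\<in>I. \<mu> i *\<^sub>R ?w i)" using \<mu> by simp
      also have "\<dots> = (\<Sum>i\<in>I. \<mu> i * (p \<bullet> p))"
        unfolding inner_sum_right using face False by (intro sum.cong) auto
      also have "\<dots> = sum \<mu> I * (p \<bullet> p)" by (simp add: sum_distrib_right)
      finally have sum\<mu>: "sum \<mu> I = 0" using pp by auto
      obtain s i0 where s: "\<And>i. i \<in> I \<Longrightarrow> 0 \<le> c i - s * \<mu> i" "i0 \<in> I" "c i0 - s * \<mu> i0 = 0"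
        using subtract_to_boundary[of I c \<mu>, OF assms(1) c(1)] False \<mu>(2) by blast
      have "(\<Sum>i\<in>I. c i - s * \<mu> i) = 1"
        by (simp add: sum_subtractf sum_distrib_left[symmetric] sum\<mu> c)
      moreover have "(\<Sum>i\<in>I. (c i - s * \<mu> i) *\<^sub>R ?w i) = p"
      proof -
        have "(\<Sum>i\<in>I. (c i - s * \<mu> i) *\<^sub>R ?w i) = (\<Sum>i\<in>I. c i *\<^sub>R ?w i) - s *\<^sub>R (\<Sum>i\<in>I. \<mu> i *\<^sub>R ?w i)"
          by (simp add: scaleR_diff_left sum_subtractf scaleR_sum_right)
        then show ?thesis by (simp add: c \<mu>)
      qed
      ultimately show ?thesis using s by (intro exI[of _ "\<lambda>i. c i - s * \<mu> i"] exI[of _ i0]) auto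
    qed
    then obtain c' i0 where c': "\<And>i. i \<in> I \<Longrightarrow> 0 \<le> c' i" "sum c' I = 1"
      "(\<Sum>i\<in>I. c' i *\<^sub>R ?w i) = p" and i0: "i0 \<in> I" "c' i0 = 0" by blast
    \<comment> \<open>The vectors of color \<open>i0\<close> sum to zero, so they cannot all have
      positive product with \<open>p\<close>.\<close>
    obtain j where j: "j \<in> J" "p \<bullet> u i0 j \<le> 0"
    proof (rule ccontr)
      assume "\<not> thesis"
      then have "0 < p \<bullet> u i0 j" if "j \<in> J" for j using that \<open>\<And>j. j \<in> J \<Longrightarrow> p \<bullet> u i0 j \<le> 0 \<Longrightarrow> thesis\<close> by force
      then have "0 < (\<Sum>j\<in>J. p \<bullet> u i0 j)" using assms(2,3) by (intro sum_pos) auto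
      also have "\<dots> = p \<bullet> (\<Sum>j\<in>J. u i0 j)" by (simp add: inner_sum_right)
      finally show False using assms(7)[OF i0(1)] by simp
    qed
    \<comment> \<open>Color \<open>i0\<close> has weight 0 in \<open>c'\<close>, so changing its
      choice keeps \<open>p\<close> in the hull, while the new vertex violates
      \<open>closest\<close>.\<close>
    let ?\<tau> = "\<sigma>(i0 := j)"
    have \<tau>: "?\<tau> \<in> ?F" using \<sigma>(1) j i0 by (auto simp: PiE_iff extensional_def)
    have "p = (\<Sum>i\<in>I. c' i *\<^sub>R u i (?\<tau> i))"
      unfolding c'(3)[symmetric] by (rule sum.cong) (use i0 in auto)
    also have "\<dots> \<in> H ?\<tau>"
      unfolding H_def by (rule convex_sum) (use assms(1) c' in \<open>auto simp del: fun_upd_apply intro!: hull_inc\<close>)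
    finally have "p \<in> H ?\<tau>" .
    moreover have "u i0 j \<in> H ?\<tau>"
      unfolding H_def using i0 by (intro hull_inc) force
    ultimately have "p \<bullet> p \<le> p \<bullet> u i0 j" using \<tau> by (intro closest)
    then show False using pp j by linarith
  qed
  then show ?thesis using that[of \<sigma> c] c \<sigma>J by simp
qed

section \<open>Sarkaria tensors\<close>

text \<open>The dimension \<open>(r - 1) (d + 1)\<close> depends on the term \<open>r\<close>, so no Euclidean space type fits; the
  sequences of finite support contain all the spaces that occur.\<close>

typedef (overloaded) 'a finsupp = "{f :: nat \<Rightarrow> 'a::zero. finite {i. f i \<noteq> 0}}"
  morphisms component Abs_finsupp
  by (rule exI[of _ "\<lambda>_. 0"]) simp

setup_lifting type_definition_finsupp

lemma finite_component: "finite {i. component f i \<noteq> 0}"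
  using component[of f] by simp

lemma finsupp_eqI: "(\<And>i. component f i = component g i) \<Longrightarrow> f = g"
  by (simp add: component_inject[symmetric] fun_eq_iff)

section \<open>Vector space and inner product on finitely supported sequences\<close>

instantiation finsupp :: (real_vector) real_vector
begin

lift_definition zero_finsupp :: "'a finsupp" is "\<lambda>_. 0" by simp

lift_definition plus_finsupp :: "'a finsupp \<Rightarrow> 'a finsupp \<Rightarrow> 'a finsupp" is "\<lambda>f g i. f i + g i"
  by (erule (1) rev_finite_subset[OF finite_UnI]) auto

lift_definition minus_finsupp :: "'a finsupp \<Rightarrow> 'a finsupp \<Rightarrow> 'a finsupp" is "\<lambda>f g i. f i - g i"
  by (erule (1) rev_finite_subset[OF finite_UnI]) auto

lift_definition uminus_finsupp :: "'a finsupp \<Rightarrow> 'a finsupp" is "\<lambda>f i. - f i" by simp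

lift_definition scaleR_finsupp :: "real \<Rightarrow> 'a finsupp \<Rightarrow> 'a finsupp" is "\<lambda>s f i. s *\<^sub>R f i"
  by (erule rev_finite_subset) auto

instance
  by standard (transfer; simp add: fun_eq_iff algebra_simps)+

end

instantiation finsupp :: (real_inner) real_inner
begin

definition inner_finsupp :: "'a finsupp \<Rightarrow> 'a finsupp \<Rightarrow> real" where
  "f \<bullet> g = (\<Sum>i | component f i \<noteq> 0. component f i \<bullet> component g i)"

definition norm_finsupp :: "'a finsupp \<Rightarrow> real" where
  "norm (f :: 'a finsupp) = sqrt (f \<bullet> f)"

definition sgn_finsupp :: "'a finsupp \<Rightarrow> 'a finsupp" where
  "sgn (f :: 'a finsupp) = f /\<^sub>R norm f"

definition dist_finsupp :: "'a finsupp \<Rightarrow> 'a finsupp \<Rightarrow> real" where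
  "dist (f :: 'a finsupp) g = norm (f - g)"

definition uniformity_finsupp :: "('a finsupp \<times> 'a finsupp) filter" where
  "(uniformity :: ('a finsupp \<times> 'a finsupp) filter) = (INF e\<in>{0 <..}. principal {(f, g). dist f g < e})"

definition open_finsupp :: "'a finsupp set \<Rightarrow> bool" where
  "open (U :: 'a finsupp set) \<longleftrightarrow> (\<forall>x\<in>U. eventually (\<lambda>(x', y). x' = x \<longrightarrow> y \<in> U) uniformity)"

text \<open>Terms outside the common support vanish. This gives all inner products in an axiom one
  index set, although the definition sums over the support of the first argument only.\<close>

lemma inner_finsupp_superset:
  assumes "finite S" "{i. component f i \<noteq> 0} \<inter> {i. component g i \<noteq> 0} \<subseteq> S"
  shows "f \<bullet> g = (\<Sum>i\<in>S. component f i \<bullet> component g i)"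
proof -
  have "f \<bullet> g = (\<Sum>i\<in>{i. component f i \<noteq> 0} \<inter> S. component f i \<bullet> component g i)"
    unfolding inner_finsupp_def
    by (rule sum.mono_neutral_right) (use assms finite_component[of f] in \<open>auto dest!: subsetD\<close>)
  also have "\<dots> = (\<Sum>i\<in>S. component f i \<bullet> component g i)"
    by (rule sum.mono_neutral_left) (use assms in auto)
  finally show ?thesis .
qed

instance
proof
  fix f g h :: "'a finsupp" and s :: real
  let ?S = "{i. component f i \<noteq> 0} \<union> {i. component g i \<noteq> 0} \<union> {i. component h i \<noteq> 0}"
  have S: "finite ?S" by (simp add: finite_component)
  note sup = inner_finsupp_superset[OF S]
  show "f \<bullet> g = g \<bullet> f"
    by (subst (1 2) sup) (auto intro: sum.cong simp: inner_commute)
  show "(f + g) \<bullet> h = f \<bullet> h + g \<bullet> h"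
    by (subst (1 2 3) sup) (auto simp: plus_finsupp.rep_eq inner_add_left sum.distrib)
  show "(s *\<^sub>R f) \<bullet> g = s * (f \<bullet> g)"
    by (subst (1 2) sup) (auto simp: scaleR_finsupp.rep_eq sum_distrib_left)
  show "0 \<le> f \<bullet> f"
    unfolding inner_finsupp_def by (simp add: sum_nonneg)
  show "f \<bullet> f = 0 \<longleftrightarrow> f = 0"
  proof
    assume "f \<bullet> f = 0"
    then have "component f i = 0" if "component f i \<noteq> 0" for i
      using that finite_component[of f] unfolding inner_finsupp_def
      by (subst (asm) sum_nonneg_eq_0_iff) auto
    then show "f = 0" by (intro finsupp_eqI) (auto simp: zero_finsupp.rep_eq)
  qed (simp add: inner_finsupp_def zero_finsupp.rep_eq)
qed (auto simp: norm_finsupp_def sgn_finsupp_def dist_finsupp_def uniformity_finsupp_def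
    open_finsupp_def)

end

lemma component_sum: "component (\<Sum>x\<in>X. f x) i = (\<Sum>x\<in>X. component (f x) i)"
  by (induction X rule: infinite_finite_induct) (auto simp: zero_finsupp.rep_eq plus_finsupp.rep_eq)

text \<open>The tensor of the \<open>k\<close>-th unit vector with \<open>e\<close>.\<close>

lift_definition at_index :: "nat \<Rightarrow> 'a \<Rightarrow> 'a::zero finsupp" is "\<lambda>k e i. if i = k then e else 0"
  by simp

lemma linear_at_index: "linear (at_index k)"
  by (rule linearI; transfer; auto simp: fun_eq_iff)

text \<open>Coordinate \<open>i\<close> of the vector \<open>v\<^sub>j\<close>: unit vectors for \<open>j < r\<close>, and minus their sum for \<open>j = r\<close>.\<close>

definition sarkaria :: "nat \<Rightarrow> nat \<Rightarrow> nat \<Rightarrow> real" where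
  "sarkaria r j i = (if i \<in> {1..<r} then if j = r then -1 else if j = i then 1 else 0 else 0)"

lemma sarkaria_nonzeroD: "sarkaria r j i \<noteq> 0 \<Longrightarrow> i \<in> {1..<r}"
  unfolding sarkaria_def by presburger

text \<open>The tensor \<open>v\<^sub>j \<otimes> e\<close>, stored as the sequence of multiples of
  \<open>e\<close> by the coordinates of \<open>v\<^sub>j\<close>.\<close>

lift_definition sarkaria_tensor :: "nat \<Rightarrow> nat \<Rightarrow> 'a \<Rightarrow> 'a::real_vector finsupp"
  is "\<lambda>r j e i. sarkaria r j i *\<^sub>R e"
proof -
  fix r j :: nat and e :: 'a
  show "finite {i. sarkaria r j i *\<^sub>R e \<noteq> 0}"
    by (rule finite_subset[of _ "{1..<r}"]) (auto dest: sarkaria_nonzeroD)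
qed

text \<open>Comes from \<open>v\<^sub>1 + \<dots> + v\<^sub>r = 0\<close>; it is the zero-sum
  condition on the color classes in \<open>colorful_caratheodory\<close>.\<close>

lemma sarkaria_tensor_sum:
  assumes "r \<ge> 2"
  shows "(\<Sum>j\<in>{1..r}. sarkaria_tensor r j e) = 0"
proof (rule finsupp_eqI)
  fix i
  have r: "{1..r} = insert r {1..<r}" using assms by auto
  have "(\<Sum>j\<in>{1..r}. sarkaria r j i) = 0"
    unfolding r by (subst sum.insert) (auto simp: sarkaria_def)
  then show "component (\<Sum>j\<in>{1..r}. sarkaria_tensor r j e) i = component 0 i"
    by (simp add: component_sum sarkaria_tensor.rep_eq zero_finsupp.rep_eq flip: scaleR_sum_left)
qed

text \<open>Bounds the dimension by \<open>r - 1\<close> times that of the space of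
  \<open>e\<close>; for lifted points \<open>(x, 1)\<close> this is \<open>(r - 1) (d + 1)\<close>,
  one less than the number of points.\<close>

lemma sarkaria_tensor_span:
  fixes e :: "'a::euclidean_space"
  shows "sarkaria_tensor r j e \<in> span ((\<lambda>(i, b). at_index i b) ` ({1..<r} \<times> Basis))"
proof -
  have "sarkaria_tensor r j e = (\<Sum>i\<in>{1..<r}. sarkaria r j i *\<^sub>R at_index i (\<Sum>b\<in>Basis. (e \<bullet> b) *\<^sub>R b))"
  proof (rule finsupp_eqI)
    fix i
    have "component (\<Sum>k\<in>{1..<r}. sarkaria r j k *\<^sub>R at_index k (\<Sum>b\<in>Basis. (e \<bullet> b) *\<^sub>R b)) i
      = (\<Sum>k\<in>{1..<r}. if k = i then sarkaria r j k *\<^sub>R e else 0)"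
      unfolding component_sum euclidean_representation
      by (rule sum.cong) (auto simp: scaleR_finsupp.rep_eq at_index.rep_eq)
    also have "\<dots> = component (sarkaria_tensor r j e) i"
      using sarkaria_nonzeroD[of r j i] by (subst sum.delta) (auto simp: sarkaria_tensor.rep_eq)
    finally show "component (sarkaria_tensor r j e) i
      = component (\<Sum>k\<in>{1..<r}. sarkaria r j k *\<^sub>R at_index k (\<Sum>b\<in>Basis. (e \<bullet> b) *\<^sub>R b)) i" ..
  qed
  also have "\<dots> = (\<Sum>i\<in>{1..<r}. sarkaria r j i *\<^sub>R (\<Sum>b\<in>Basis. (e \<bullet> b) *\<^sub>R at_index i b))"
    by (simp only: linear_sum[OF linear_at_index] linear_cmul[OF linear_at_index])
  also have "\<dots> \<in> span ((\<lambda>(i, b). at_index i b) ` ({1..<r} \<times> Basis))"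
    by (intro span_sum span_scale span_base) auto
  finally show ?thesis .
qed

text \<open>The inner product of tensors factors, so Gram entries are polynomial in the coordinates
  of the points.\<close>

lemma sarkaria_tensor_inner:
  fixes e e' :: "'a::real_inner"
  shows "sarkaria_tensor r j e \<bullet> sarkaria_tensor r k e'
    = (\<Sum>i\<in>{1..<r}. sarkaria r j i * sarkaria r k i) * (e \<bullet> e')"
proof -
  have "sarkaria_tensor r j e \<bullet> sarkaria_tensor r k e' =
    (\<Sum>i\<in>{1..<r}. component (sarkaria_tensor r j e) i \<bullet> component (sarkaria_tensor r k e') i)"
    by (intro inner_finsupp_superset) (auto simp: sarkaria_tensor.rep_eq dest: sarkaria_nonzeroD)
  then show ?thesis by (simp add: sarkaria_tensor.rep_eq sum_distrib_left ac_simps)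
qed

text \<open>Up to a factor, \<open>v\<^sub>1 + \<dots> + v\<^sub>r = 0\<close> is the only relation
  among the \<open>v\<^sub>j\<close>. Concretely, component \<open>i\<close> of the sum is the sum
  over block \<open>i\<close> minus the sum over block \<open>r\<close>.\<close>

lemma sarkaria_tensor_sum_eq_0_iff:
  assumes "finite X" "\<And>x. x \<in> X \<Longrightarrow> \<sigma> x \<in> {1..r}"
  shows "(\<Sum>x\<in>X. \<alpha> x *\<^sub>R sarkaria_tensor r (\<sigma> x) (e x)) = 0 \<longleftrightarrow>
    (\<forall>j\<in>{1..r}. (\<Sum>x\<in>{x\<in>X. \<sigma> x = j}. \<alpha> x *\<^sub>R e x) = (\<Sum>x\<in>{x\<in>X. \<sigma> x = r}. \<alpha> x *\<^sub>R e x))"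
proof -
  let ?V = "\<Sum>x\<in>X. \<alpha> x *\<^sub>R sarkaria_tensor r (\<sigma> x) (e x)"
  let ?B = "\<lambda>j. \<Sum>x\<in>{x\<in>X. \<sigma> x = j}. \<alpha> x *\<^sub>R e x"
  have comp: "component ?V i = (if i \<in> {1..<r} then ?B i - ?B r else 0)" for i
  proof -
    have "component ?V i = (\<Sum>x\<in>X. (\<alpha> x * sarkaria r (\<sigma> x) i) *\<^sub>R e x)"
      by (simp add: component_sum scaleR_finsupp.rep_eq sarkaria_tensor.rep_eq)
    also have "\<dots> = (\<Sum>x\<in>X. if i \<in> {1..<r} then (if \<sigma> x = i then \<alpha> x *\<^sub>R e x else 0)
        - (if \<sigma> x = r then \<alpha> x *\<^sub>R e x else 0) else 0)"
      by (rule sum.cong) (auto simp: sarkaria_def)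
    also have "\<dots> = (if i \<in> {1..<r} then ?B i - ?B r else 0)"
    proof (cases "i \<in> {1..<r}")
      case True
      then show ?thesis using assms(1) by (simp add: sum_subtractf sum.inter_filter)
    qed auto
    finally show ?thesis .
  qed
  have "?V = 0 \<longleftrightarrow> (\<forall>i. component ?V i = 0)"
    by (metis finsupp_eqI zero_finsupp.rep_eq)
  also have "\<dots> \<longleftrightarrow> (\<forall>i\<in>{1..<r}. ?B i = ?B r)" by (auto simp: comp)
  also have "\<dots> \<longleftrightarrow> (\<forall>j\<in>{1..r}. ?B j = ?B r)" by (auto simp: le_less)
  finally show ?thesis .
qed

section \<open>Generic independence of the tensors\<close>

text \<open>Greedy choice: one set takes as much of \<open>D'\<close> as its size allows and is
  padded inside \<open>D\<close>; the rest of \<open>D'\<close> is left to the other sets. Hence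
  \<open>D'\<close> varies in the induction while \<open>D\<close> is fixed.\<close>

lemma cover_with_prescribed_cards:
  assumes "finite J" "finite D" "\<And>j. j \<in> J \<Longrightarrow> k j \<le> card D" "D' \<subseteq> D" "card D' \<le> sum k J"
  shows "\<exists>C. (\<forall>j\<in>J. C j \<subseteq> D \<and> card (C j) = k j) \<and> D' \<subseteq> (\<Union>j\<in>J. C j)"
  using assms(1,3-)
proof (induction J arbitrary: D' rule: finite_induct)
  case empty
  then show ?case using assms(2) finite_subset by fastforce
next
  case (insert a J)
  have finD': "finite D'" using insert.prems(2) assms(2) by (rule finite_subset)
  obtain E where E: "E \<subseteq> D'" "card E = min (k a) (card D')" "finite E"
    by (rule obtain_subset_with_card_n[of "min (k a) (card D')" D']) auto
  obtain X where X: "E \<subseteq> X" "X \<subseteq> D" "card X = k a"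
    using exists_subset_between[of E "k a" D] E insert.prems(1)[of a] insert.prems(2) assms(2) by auto
  have "card (D' - E) \<le> sum k J"
    using insert.prems(3) insert.hyps E finD' by (auto simp: card_Diff_subset)
  then obtain C where C: "\<forall>j\<in>J. C j \<subseteq> D \<and> card (C j) = k j" "D' - E \<subseteq> (\<Union>j\<in>J. C j)"
    using insert.IH[of "D' - E"] insert.prems by auto
  show ?case
    by (intro exI[of _ "C(a := X)"]) (use C X insert.hyps in \<open>auto split: if_splits\<close>)
qed

lemma sum_card_fibres:
  assumes "finite T" "finite J" "\<And>x. x \<in> T \<Longrightarrow> \<sigma> x \<in> J"
  shows "(\<Sum>j\<in>J. card {x\<in>T. \<sigma> x = j}) = card T"
  using sum.group[of T J \<sigma> "\<lambda>_. 1 :: nat"] assms by (auto simp: image_subset_iff)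

text \<open>Choose first the sets \<open>C j\<close> of labels that block \<open>j\<close> omits.
  Altogether \<open>card J * card D - card T\<close> omissions are available, at least
  \<open>card D\<close>, so the \<open>C j\<close> can cover \<open>D\<close>; then each block is
  matched with its remaining labels.\<close>

lemma blockwise_injection:
  assumes "finite T" "finite J" "finite D" "\<And>x. x \<in> T \<Longrightarrow> \<sigma> x \<in> J"
    and "\<And>j. j \<in> J \<Longrightarrow> card {x\<in>T. \<sigma> x = j} \<le> card D"
    and "card T + card D \<le> card J * card D"
  shows "\<exists>g. (\<forall>j\<in>J. inj_on g {x\<in>T. \<sigma> x = j}) \<and>
    (\<forall>l\<in>D. \<exists>j\<in>J. \<forall>x\<in>T. \<sigma> x = j \<longrightarrow> g x \<noteq> l)"
proof -
  let ?b = "\<lambda>j. {x\<in>T. \<sigma> x = j}"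
  \<comment> \<open>The number of labels omitted by block \<open>j\<close>; the subtraction is not
    truncated, since no block exceeds \<open>card D\<close>.\<close>
  define k where "k = (\<lambda>j. card D - card (?b j))"
  have "sum k J + card T = (\<Sum>j\<in>J. k j + card (?b j))"
    using sum_card_fibres[OF assms(1,2,4)] by (simp add: sum.distrib)
  also have "\<dots> = card J * card D" using assms(5) by (simp add: k_def)
  finally have "card D \<le> sum k J" using assms(6) by linarith
  then obtain C where C: "\<forall>j\<in>J. C j \<subseteq> D \<and> card (C j) = k j" "D \<subseteq> (\<Union>j\<in>J. C j)"
    using cover_with_prescribed_cards[of J D k D] assms(2,3) by (auto simp: k_def)
  have "\<exists>h. bij_betw h (?b j) (D - C j)" if "j \<in> J" for j
  proof (rule finite_same_card_bij)
    show "card (?b j) = card (D - C j)"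
      using C(1) that assms(3) assms(5)[OF that] by (auto simp: card_Diff_subset finite_subset k_def)
  qed (use assms in auto)
  then obtain h where h: "\<And>j. j \<in> J \<Longrightarrow> bij_betw (h j) (?b j) (D - C j)" by metis
  show ?thesis
  proof (intro exI[of _ "\<lambda>x. h (\<sigma> x) x"] conjI ballI)
    fix j assume "j \<in> J"
    then show "inj_on (\<lambda>x. h (\<sigma> x) x) (?b j)"
      using h[of j] by (auto simp: bij_betw_def inj_on_def)
  next
    fix l assume "l \<in> D"
    then obtain j where j: "j \<in> J" "l \<in> C j" using C(2) by blast
    then show "\<exists>j\<in>J. \<forall>x\<in>T. \<sigma> x = j \<longrightarrow> h (\<sigma> x) x \<noteq> l"
      using h[OF j(1)] by (intro bexI[of _ j]) (auto simp: bij_betw_def)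
  qed
qed

section \<open>A special configuration on the vertices of the standard simplex\<close>

definition simplex_vertex :: "'n option \<Rightarrow> real ^ 'n" where
  "simplex_vertex k = (case k of None \<Rightarrow> 0 | Some i \<Rightarrow> axis i 1)"

text \<open>Homogeneous form of the barycentric coordinates: linear on pairs, so it applies to sums
  of lifted points, and at \<open>(x, 1)\<close> it is the usual coordinate of
  \<open>x\<close>.\<close>

definition barycentric :: "'n option \<Rightarrow> (real ^ 'n) \<times> real \<Rightarrow> real" where
  "barycentric k e = (case k of None \<Rightarrow> snd e - (\<Sum>i\<in>UNIV. fst e $ i) | Some i \<Rightarrow> fst e $ i)"

lemma linear_barycentric: "linear (barycentric k)"
  by (rule linearI)
    (auto simp: barycentric_def sum.distrib sum_distrib_left right_diff_distrib split: option.splits)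

lemma barycentric_simplex_vertex:
  "barycentric l (simplex_vertex k, 1) = (if k = l then 1 else 0)"
  by (auto simp: barycentric_def simplex_vertex_def axis_def split: option.splits)

text \<open>Place the points of each block at distinct simplex vertices so that every vertex is
  missed by some block. A dependence makes the block sums equal; at the vertex of \<open>x0\<close>
  the barycentric coordinate is \<open>\<mu> x0\<close> for the block of \<open>x0\<close>, and 0
  for a block missing that vertex.\<close>

lemma sarkaria_tensor_independent_special:
  fixes T :: "'x set"
  assumes "finite T" "r \<ge> 1" "\<And>x. x \<in> T \<Longrightarrow> \<sigma> x \<in> {1..r}"
    and "\<And>j. j \<in> {1..r} \<Longrightarrow> card {x\<in>T. \<sigma> x = j} \<le> CARD('n) + 1"
    and "card T \<le> (r - 1) * (CARD('n) + 1)"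
  obtains y :: "'x \<Rightarrow> real ^ 'n" where
    "\<And>\<mu>. (\<Sum>x\<in>T. \<mu> x *\<^sub>R sarkaria_tensor r (\<sigma> x) (y x, 1 :: real)) = 0 \<Longrightarrow> \<forall>x\<in>T. \<mu> x = 0"
proof -
  let ?b = "\<lambda>j. {x\<in>T. \<sigma> x = j}"
  have D: "card (UNIV :: 'n option set) = CARD('n) + 1" by (simp add: card_UNIV_option)
  have "card T + (CARD('n) + 1) \<le> (r - 1) * (CARD('n) + 1) + (CARD('n) + 1)"
    using assms(5) by simp
  also have "\<dots> = r * (CARD('n) + 1)" using assms(2) by (cases r) auto
  finally have le: "card T + card (UNIV :: 'n option set) \<le> card {1..r} * card (UNIV :: 'n option set)"
    by (simp only: D card_atLeastAtMost) simp
  have "\<exists>g :: 'x \<Rightarrow> 'n option. (\<forall>j\<in>{1..r}. inj_on g (?b j)) \<and>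
      (\<forall>l\<in>UNIV. \<exists>j\<in>{1..r}. \<forall>x\<in>T. \<sigma> x = j \<longrightarrow> g x \<noteq> l)"
    by (rule blockwise_injection[OF assms(1) finite_atLeastAtMost finite assms(3) _ le])
      (use assms(4) D in auto)
  then obtain g :: "'x \<Rightarrow> 'n option" where g: "\<And>j. j \<in> {1..r} \<Longrightarrow> inj_on g (?b j)"
    "\<And>l. \<exists>j\<in>{1..r}. \<forall>x\<in>T. \<sigma> x = j \<longrightarrow> g x \<noteq> l"
    by blast
  show ?thesis
  proof (rule that[of "\<lambda>x. simplex_vertex (g x)"], intro ballI)
    fix \<mu> x0
    assume dep: "(\<Sum>x\<in>T. \<mu> x *\<^sub>R sarkaria_tensor r (\<sigma> x) (simplex_vertex (g x) :: real ^ 'n, 1 :: real)) = 0"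
      and x0: "x0 \<in> T"
    let ?B = "\<lambda>j. \<Sum>x\<in>?b j. \<mu> x *\<^sub>R (simplex_vertex (g x) :: real ^ 'n, 1 :: real)"
    have eq: "?B j = ?B r" if "j \<in> {1..r}" for j
      using sarkaria_tensor_sum_eq_0_iff[OF assms(1,3), THEN iffD1, OF _ dep] that by blast
    have coord: "barycentric l (?B j) = (\<Sum>x\<in>?b j. if g x = l then \<mu> x else 0)" for l j
      unfolding linear_sum[OF linear_barycentric] linear_cmul[OF linear_barycentric]
        barycentric_simplex_vertex by (rule sum.cong) auto
    obtain j where j: "j \<in> {1..r}" "\<forall>x\<in>T. \<sigma> x = j \<longrightarrow> g x \<noteq> g x0" using g(2) by blast
    have "\<mu> x0 = (\<Sum>x\<in>{x0}. if g x = g x0 then \<mu> x else 0)" by simp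
    also have "\<dots> = (\<Sum>x\<in>?b (\<sigma> x0). if g x = g x0 then \<mu> x else 0)"
      by (rule sum.mono_neutral_left)
        (use assms(1,3) x0 g(1)[of "\<sigma> x0"] in \<open>auto simp: inj_on_def\<close>)
    also have "\<dots> = barycentric (g x0) (?B j)"
      using eq[of j] eq[of "\<sigma> x0"] j(1) assms(3)[OF x0] unfolding coord[symmetric] by simp
    also have "\<dots> = 0" unfolding coord by (rule sum.neutral) (use j(2) in auto)
    finally show "\<mu> x0 = 0" .
  qed
qed

text \<open>A combination orthogonal to every \<open>u x\<close> is orthogonal to itself, hence
  zero. So one square determinant tests independence, whatever the dimension of the ambient
  space.\<close>

lemma gram_kernel:
  fixes u :: "'i \<Rightarrow> 'v::real_inner"
  shows "(\<forall>x\<in>T. (\<Sum>y\<in>T. (u x \<bullet> u y) * \<mu> y) = 0) \<longleftrightarrow> (\<Sum>y\<in>T. \<mu> y *\<^sub>R u y) = 0"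
proof -
  let ?w = "\<Sum>y\<in>T. \<mu> y *\<^sub>R u y"
  have w: "u x \<bullet> ?w = (\<Sum>y\<in>T. (u x \<bullet> u y) * \<mu> y)" for x
    by (simp add: inner_sum_right mult.commute)
  have "?w \<bullet> ?w = (\<Sum>x\<in>T. \<mu> x * (u x \<bullet> ?w))" by (simp add: inner_sum_left)
  then have "?w = 0" if "\<forall>x\<in>T. u x \<bullet> ?w = 0" using that by simp
  then show ?thesis unfolding w[symmetric] by auto
qed

lemma polynomial_fun_sarkaria: "polynomial_fun I (\<lambda>c. sarkaria r j i)"
  using polynomial_fun_of_int[of I 0] polynomial_fun_of_int[of I 1] polynomial_fun_of_int[of I "-1"]
  by (simp add: sarkaria_def)

text \<open>The Gram determinant is a polynomial in the coordinates and nonzero at the simplex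
  configuration, hence nonzero at the given points.\<close>

lemma sarkaria_tensor_independent_generic:
  fixes A T :: "(real ^ 'n) set"
  assumes "alg_indep_on (A \<times> UNIV) (\<lambda>(x, i). x $ i)" "T \<subseteq> A"
    and "finite T" "r \<ge> 1" "\<And>x. x \<in> T \<Longrightarrow> \<sigma> x \<in> {1..r}"
    and "\<And>j. j \<in> {1..r} \<Longrightarrow> card {x\<in>T. \<sigma> x = j} \<le> CARD('n) + 1"
    and "card T \<le> (r - 1) * (CARD('n) + 1)"
    and "(\<Sum>x\<in>T. \<mu> x *\<^sub>R sarkaria_tensor r (\<sigma> x) (x, 1 :: real)) = 0"
  shows "\<forall>x\<in>T. \<mu> x = 0"
proof -
  \<comment> \<open>Points of \<open>T\<close> act only as labels here: their positions are read
    from \<open>c\<close>, so they may be moved, even onto each other, while \<open>\<sigma>\<close>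
    stays fixed.\<close>
  define u :: "((real ^ 'n) \<times> 'n \<Rightarrow> real) \<Rightarrow> real ^ 'n \<Rightarrow> ((real ^ 'n) \<times> real) finsupp"
    where "u = (\<lambda>c x. sarkaria_tensor r (\<sigma> x) (\<chi> i. c (x, i), 1))"
  define n where "n = card T"
  obtain h where h: "bij_betw h {0..<n} T"
    using ex_bij_betw_nat_finite[OF assms(3)] unfolding n_def by blast
  then have hT: "h i \<in> T" if "i < n" for i using that by (auto simp: bij_betw_def)
  define f where "f = (\<lambda>c. Determinant.det (mat n n (\<lambda>(i, j). u c (h i) \<bullet> u c (h j))))"
  have f: "f c \<noteq> 0 \<longleftrightarrow> (\<forall>\<mu>. (\<Sum>x\<in>T. \<mu> x *\<^sub>R u c x) = 0 \<longrightarrow> (\<forall>x\<in>T. \<mu> x = 0))" for c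
    unfolding f_def det_ne_0_iff_kernel_trivial[OF h, of "\<lambda>x y. u c x \<bullet> u c y"] gram_kernel ..
  have "polynomial_fun (A \<times> UNIV) f"
    unfolding f_def
  proof (rule polynomial_fun_det)
    fix i j assume ij: "i < n" "j < n"
    \<comment> \<open>The summand 1 comes from the last coordinates of the lifted points.\<close>
    have "u c (h i) \<bullet> u c (h j) = (\<Sum>k\<in>{1..<r}. sarkaria r (\<sigma> (h i)) k * sarkaria r (\<sigma> (h j)) k) *
        ((\<Sum>l\<in>UNIV. c (h i, l) * c (h j, l)) + of_int 1)" for c
      by (simp add: u_def sarkaria_tensor_inner inner_vec_def)
    then show "polynomial_fun (A \<times> UNIV) (\<lambda>c. u c (h i) \<bullet> u c (h j))"
      using hT[OF ij(1)] hT[OF ij(2)] assms(2)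
      by (simp only:) (intro polynomial_fun_sum polynomial_fun_mult polynomial_fun_add
          polynomial_fun_sarkaria polynomial_fun_var polynomial_fun_of_int; auto)
  qed
  moreover obtain y :: "real ^ 'n \<Rightarrow> real ^ 'n" where
    "\<And>\<mu>. (\<Sum>x\<in>T. \<mu> x *\<^sub>R sarkaria_tensor r (\<sigma> x) (y x, 1 :: real)) = 0 \<Longrightarrow> \<forall>x\<in>T. \<mu> x = 0"
    using sarkaria_tensor_independent_special[OF assms(3-7)] by blast
  then have "f (\<lambda>(x, i). y x $ i) \<noteq> 0" unfolding f by (simp add: u_def)
  ultimately have "f (\<lambda>(x, i). x $ i) \<noteq> 0"
    using alg_indep_on_polynomial_fun_nonzero[OF assms(1)] by blast
  then show ?thesis using assms(8) unfolding f by (simp add: u_def)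
qed

section \<open>Prescribed signs\<close>

text \<open>If the weight on \<open>A - M\<close> were positive, dividing by it would turn the two
  halves of the dependence into one point common to both hulls. With weight zero, the signs make
  every coefficient vanish.\<close>

lemma separated_sign_dependence_trivial:
  fixes A M :: "'a::real_vector set"
  assumes "finite A" "M \<subseteq> A" "convex hull M \<inter> convex hull (A - M) = {}"
    and "\<And>x. x \<in> M \<Longrightarrow> \<alpha> x \<le> 0" "\<And>x. x \<in> A - M \<Longrightarrow> 0 \<le> \<alpha> x"
    and "sum \<alpha> A = 0" "(\<Sum>x\<in>A. \<alpha> x *\<^sub>R x) = 0"
  shows "\<forall>x\<in>A. \<alpha> x = 0"
proof -
  let ?s = "sum \<alpha> (A - M)"
  have finM: "finite M" using assms(1,2) finite_subset by blast
  have s: "sum \<alpha> M = - ?s" and v: "(\<Sum>x\<in>M. \<alpha> x *\<^sub>R x) = - (\<Sum>x\<in>A - M. \<alpha> x *\<^sub>R x)"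
    using sum.subset_diff[OF assms(2,1), of \<alpha>] sum.subset_diff[OF assms(2,1), of "\<lambda>x. \<alpha> x *\<^sub>R x"] assms(6,7)
    by (simp_all add: add_eq_0_iff)
  have "?s = 0"
  proof (rule ccontr)
    assume "?s \<noteq> 0"
    then have pos: "?s > 0" using sum_nonneg[of "A - M" \<alpha>] assms(5) by force
    have "(\<Sum>x\<in>A - M. (\<alpha> x / ?s) *\<^sub>R x) \<in> convex hull (A - M)"
      by (rule convex_sum)
        (use assms(1,5) pos in \<open>auto intro: hull_inc simp: sum_divide_distrib[symmetric]\<close>)
    moreover have "(\<Sum>x\<in>M. (- \<alpha> x / ?s) *\<^sub>R x) \<in> convex hull M"
      by (rule convex_sum)
        (use finM assms(4) pos s in \<open>auto intro: hull_inc divide_nonpos_pos simp: sum_negf sum_divide_distrib[symmetric]\<close>)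
    moreover have "(\<Sum>x\<in>M. (- \<alpha> x / ?s) *\<^sub>R x) = (- 1 / ?s) *\<^sub>R (\<Sum>x\<in>M. \<alpha> x *\<^sub>R x)"
      by (simp add: scaleR_sum_right sum_negf)
    moreover have "(\<Sum>x\<in>A - M. (\<alpha> x / ?s) *\<^sub>R x) = (1 / ?s) *\<^sub>R (\<Sum>x\<in>A - M. \<alpha> x *\<^sub>R x)"
      by (simp add: scaleR_sum_right)
    ultimately show False using assms(3) v by auto
  qed
  then have "\<alpha> x = 0" if "x \<in> A - M" for x
    using that assms(1,5) by (subst (asm) sum_nonneg_eq_0_iff) auto
  moreover have "(\<Sum>x\<in>M. - \<alpha> x) = 0" using s \<open>?s = 0\<close> by (simp add: sum_negf)
  then have "\<alpha> x = 0" if "x \<in> M" for x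
    using that finM assms(4) by (subst (asm) sum_nonneg_eq_0_iff) auto
  ultimately show ?thesis by blast
qed

theorem mainTheorem2:
  fixes r :: nat and A M :: "(real ^ 'n) set"
  assumes "r \<ge> 2"
    and "finite A"
    and "card A = (r - 1) * (CARD('n) + 1) + 1"
    and "alg_indep_on (A \<times> UNIV) (\<lambda>(x, i). x $ i)"
    and "M \<subseteq> A"
    and "card M \<le> r - 1"
    and "convex hull M \<inter> convex hull (A - M) = {}"
  shows "\<exists>P :: nat \<Rightarrow> (real ^ 'n) set.
           (\<forall>j\<in>{1..r}. P j \<noteq> {}) \<and> disjoint_family_on P {1..r} \<and>
           (\<Union>j\<in>{1..r}. P j) = A \<and>
           (\<exists>(z :: real ^ 'n) (\<alpha> :: real ^ 'n \<Rightarrow> real).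
              (\<forall>j\<in>{1..r}. z = (\<Sum>x\<in>P j. \<alpha> x *\<^sub>R x) \<and> (\<Sum>x\<in>P j. \<alpha> x) = 1) \<and>
              (\<forall>x\<in>A. \<alpha> x < 0 \<longleftrightarrow> x \<in> M))"
proof -
  \<comment> \<open>With the signs moved into the tensors, the nonnegative coefficients of
    \<open>colorful_caratheodory\<close> become coefficients of prescribed weak sign.\<close>
  define \<epsilon> :: "real ^ 'n \<Rightarrow> real" where "\<epsilon> = (\<lambda>x. if x \<in> M then -1 else 1)"
  have \<epsilon>2: "\<epsilon> x * \<epsilon> x = 1" for x by (simp add: \<epsilon>_def)
  define w :: "nat \<Rightarrow> real ^ 'n \<Rightarrow> ((real ^ 'n) \<times> real) finsupp"
    where "w = (\<lambda>j x. sarkaria_tensor r j (x, 1))"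
  have r1: "r \<ge> 1" using assms(1) by simp
  have finM: "finite M" using assms(2,5) by (rule rev_finite_subset)
  let ?B = "(\<lambda>(i, b). at_index i b) ` ({1..<r} \<times> (Basis :: ((real ^ 'n) \<times> real) set))"
  have "card ?B \<le> card ({1..<r} \<times> (Basis :: ((real ^ 'n) \<times> real) set))"
    by (rule card_image_le) simp
  also have "\<dots> < card A" unfolding assms(3) by (simp add: card_cartesian_product)
  finally have cardB: "card ?B < card A" .
  \<comment> \<open>The points are the colors and the block indices the choices within a color, so a
    transversal \<open>\<sigma>\<close> is an assignment of points to blocks.\<close>
  obtain \<sigma> \<beta> where \<sigma>: "\<And>x. x \<in> A \<Longrightarrow> \<sigma> x \<in> {1..r}" and \<beta>: "\<And>x. x \<in> A \<Longrightarrow> 0 \<le> \<beta> x" "sum \<beta> A = 1"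
    "(\<Sum>x\<in>A. \<beta> x *\<^sub>R (\<epsilon> x *\<^sub>R w (\<sigma> x) x)) = 0"
  proof (rule colorful_caratheodory[of A "{1..r}" ?B "\<lambda>x j. \<epsilon> x *\<^sub>R w j x"])
    show "\<epsilon> x *\<^sub>R w j x \<in> span ?B" for x j
      unfolding w_def by (intro span_scale sarkaria_tensor_span)
    show "(\<Sum>j\<in>{1..r}. \<epsilon> x *\<^sub>R w j x) = 0" for x
      using sarkaria_tensor_sum[OF assms(1), of "(x, 1 :: real)"]
      by (simp add: w_def scaleR_sum_right[symmetric])
  qed (use assms(1,2) cardB in auto)
  define b where "b = (\<lambda>j. {x\<in>A. \<sigma> x = j})"
  have finb: "finite (b j)" for j using assms(2) by (simp add: b_def)
  have sum_blocks: "(\<Sum>j\<in>{1..r}. sum f (b j)) = sum f A" for f :: "real ^ 'n \<Rightarrow> 'z::comm_monoid_add"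
    unfolding b_def using assms(2) \<sigma> by (intro sum.group) auto
  have dependence_iff: "(\<Sum>x\<in>A. \<alpha> x *\<^sub>R w (\<sigma> x) x) = 0 \<longleftrightarrow>
      (\<forall>j\<in>{1..r}. (\<Sum>x\<in>b j. \<alpha> x *\<^sub>R (x, 1 :: real)) = (\<Sum>x\<in>b r. \<alpha> x *\<^sub>R (x, 1)))" for \<alpha>
    unfolding w_def b_def using assms(2) \<sigma> by (rule sarkaria_tensor_sum_eq_0_iff)
  \<comment> \<open>Zero coefficients are still allowed; they are excluded at the end by
    genericity.\<close>
  define Sol where "Sol = (\<lambda>\<alpha>. (\<forall>x\<in>A. 0 \<le> \<alpha> x * \<epsilon> x) \<and> (\<exists>x\<in>A. \<alpha> x \<noteq> 0) \<and>
    (\<Sum>x\<in>A. \<alpha> x *\<^sub>R w (\<sigma> x) x) = 0)"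
  have eq_vec: "(\<Sum>x\<in>b j. \<alpha> x *\<^sub>R x) = (\<Sum>x\<in>b r. \<alpha> x *\<^sub>R x)"
    and eq_sum: "sum \<alpha> (b j) = sum \<alpha> (b r)" if "Sol \<alpha>" "j \<in> {1..r}" for \<alpha> j
  proof -
    have "(\<Sum>x\<in>b j. \<alpha> x *\<^sub>R (x, 1 :: real)) = (\<Sum>x\<in>b r. \<alpha> x *\<^sub>R (x, 1))"
      using that unfolding Sol_def dependence_iff by blast
    from arg_cong[OF this, of fst] arg_cong[OF this, of snd]
    show "(\<Sum>x\<in>b j. \<alpha> x *\<^sub>R x) = (\<Sum>x\<in>b r. \<alpha> x *\<^sub>R x)" "sum \<alpha> (b j) = sum \<alpha> (b r)"
      by (simp_all add: fst_sum snd_sum)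
  qed
  \<comment> \<open>Fewer than \<open>r\<close> points lie in \<open>M\<close>, so some block avoids
    \<open>M\<close> and has nonnegative coefficients. If the common sum were not positive, that
    block would vanish, hence all block sums, and separation would make \<open>\<alpha>\<close>
    zero.\<close>
  have sum_pos: "sum \<alpha> (b r) > 0" if "Sol \<alpha>" for \<alpha>
  proof (rule ccontr)
    assume neg: "\<not> sum \<alpha> (b r) > 0"
    have sign: "0 \<le> \<alpha> x * \<epsilon> x" if "x \<in> A" for x using \<open>Sol \<alpha>\<close> that by (simp add: Sol_def)
    have "card (\<sigma> ` M) < card {1..r}"
      using card_image_le[OF finM, of \<sigma>] assms(1,6) by simp
    then have "\<not> {1..r} \<subseteq> \<sigma> ` M" using card_mono[of "\<sigma> ` M" "{1..r}"] finM by auto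
    then obtain j where j: "j \<in> {1..r}" "j \<notin> \<sigma> ` M" by blast
    have nonneg: "0 \<le> \<alpha> x" if "x \<in> b j" for x
      using that j(2) sign[of x] by (auto simp: b_def \<epsilon>_def split: if_splits)
    then have "sum \<alpha> (b j) = 0" using neg sum_nonneg[of "b j" \<alpha>] eq_sum[OF \<open>Sol \<alpha>\<close> j(1)] by simp
    then have "\<forall>x\<in>b j. \<alpha> x = 0" using nonneg finb by (simp add: sum_nonneg_eq_0_iff)
    then have "(\<Sum>x\<in>b j. \<alpha> x *\<^sub>R x) = 0" by simp
    then have "(\<Sum>x\<in>b k. \<alpha> x *\<^sub>R x) = 0" "sum \<alpha> (b k) = 0" if "k \<in> {1..r}" for k
      using eq_vec[OF \<open>Sol \<alpha>\<close> j(1)] eq_vec[OF \<open>Sol \<alpha>\<close> that] eq_sum[OF \<open>Sol \<alpha>\<close> j(1)]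
        eq_sum[OF \<open>Sol \<alpha>\<close> that] \<open>sum \<alpha> (b j) = 0\<close> by simp_all
    then have "sum \<alpha> A = 0" "(\<Sum>x\<in>A. \<alpha> x *\<^sub>R x) = 0"
      using sum_blocks[of \<alpha>] sum_blocks[of "\<lambda>x. \<alpha> x *\<^sub>R x"] by simp_all
    moreover have "\<alpha> x \<le> 0" if "x \<in> M" for x
      using sign[of x] that assms(5) by (auto simp: \<epsilon>_def)
    moreover have "0 \<le> \<alpha> x" if "x \<in> A - M" for x
      using sign[of x] that by (auto simp: \<epsilon>_def)
    ultimately have "\<forall>x\<in>A. \<alpha> x = 0"
      using separated_sign_dependence_trivial[OF assms(2,5,7)] by blast
    then show False using \<open>Sol \<alpha>\<close> by (auto simp: Sol_def)
  qed

  \<comment> \<open>Solutions of minimal support\<close>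
  define supp where "supp = (\<lambda>\<alpha> :: real ^ 'n \<Rightarrow> real. {x\<in>A. \<alpha> x \<noteq> 0})"
  have "Sol (\<lambda>x. \<beta> x * \<epsilon> x)"
  proof -
    have "\<exists>x\<in>A. \<beta> x \<noteq> 0" using \<beta>(2) sum.neutral[of A \<beta>] by fastforce
    then show ?thesis using \<beta> by (auto simp: Sol_def \<epsilon>_def)
  qed
  then obtain \<alpha> where sol: "Sol \<alpha>" and minimal: "\<And>\<alpha>'. Sol \<alpha>' \<Longrightarrow> card (supp \<alpha>) \<le> card (supp \<alpha>')"
    using ex_has_least_nat[of Sol _ "\<lambda>\<alpha>. card (supp \<alpha>)"] by blast
  have sign: "0 \<le> \<alpha> x * \<epsilon> x" if "x \<in> A" for x using sol that by (simp add: Sol_def)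
  define T where "T = supp \<alpha>"
  have T: "T \<subseteq> A" "finite T" using assms(2) by (auto simp: T_def supp_def)
  \<comment> \<open>More than \<open>d + 1\<close> lifted points in one block are dependent.
    Subtracting a multiple of that dependence shrinks the support, so by minimality nothing may
    remain; then \<open>\<alpha>\<close> is a multiple of a dependence with zero block sums, against
    \<open>sum_pos\<close>.\<close>
  have "card {x\<in>T. \<sigma> x = j} \<le> CARD('n) + 1" if j: "j \<in> {1..r}" for j
  proof (rule ccontr)
    let ?Tj = "{x\<in>T. \<sigma> x = j}"
    assume "\<not> card ?Tj \<le> CARD('n) + 1"
    then have "card (Basis :: ((real ^ 'n) \<times> real) set) < card ?Tj" by simp
    then obtain \<mu>0 where \<mu>0: "(\<Sum>x\<in>?Tj. \<mu>0 x *\<^sub>R (x, 1 :: real)) = 0" "\<exists>x\<in>?Tj. \<mu>0 x \<noteq> 0"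
      using family_dependent[of Basis ?Tj "\<lambda>x. (x, 1 :: real)"] by auto
    define \<mu> where "\<mu> = (\<lambda>x. if x \<in> ?Tj then \<mu>0 x else 0)"
    have \<mu>_block: "(\<Sum>x\<in>b k. \<mu> x *\<^sub>R (x, 1 :: real)) = 0" for k
    proof (cases "k = j")
      case True
      have "(\<Sum>x\<in>b k. \<mu> x *\<^sub>R (x, 1 :: real)) = (\<Sum>x\<in>?Tj. \<mu> x *\<^sub>R (x, 1))"
        by (rule sum.mono_neutral_right) (use T finb True in \<open>auto simp: b_def \<mu>_def zero_prod_def\<close>)
      also have "\<dots> = 0" using \<mu>0(1) by (simp add: \<mu>_def)
      finally show ?thesis .
    next
      case False
      then show ?thesis by (intro sum.neutral) (auto simp: b_def \<mu>_def zero_prod_def)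
    qed
    have "\<mu> x * \<epsilon> x \<noteq> 0 \<Longrightarrow> \<alpha> x * \<epsilon> x \<noteq> 0" for x
      by (auto simp: \<mu>_def \<epsilon>_def T_def supp_def split: if_splits)
    moreover have "\<exists>x\<in>A. \<mu> x * \<epsilon> x \<noteq> 0" using \<mu>0(2) T by (auto simp: \<mu>_def \<epsilon>_def)
    \<comment> \<open>Multiplying by \<open>\<epsilon>\<close> makes the sign conditions
      nonnegativity, as the ratio test requires.\<close>
    ultimately obtain s x0 where s: "\<And>x. x \<in> A \<Longrightarrow> 0 \<le> \<alpha> x * \<epsilon> x - s * (\<mu> x * \<epsilon> x)" "x0 \<in> A"
      "\<alpha> x0 * \<epsilon> x0 \<noteq> 0" "\<alpha> x0 * \<epsilon> x0 - s * (\<mu> x0 * \<epsilon> x0) = 0"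
      using subtract_to_boundary[of A "\<lambda>x. \<alpha> x * \<epsilon> x" "\<lambda>x. \<mu> x * \<epsilon> x", OF assms(2) sign] by blast
    let ?\<alpha> = "\<lambda>x. \<alpha> x - s * \<mu> x"
    have "?\<alpha> x0 = 0" "\<alpha> x0 \<noteq> 0" using s(3,4) \<epsilon>2[of x0] by (auto simp: \<epsilon>_def split: if_splits)
    then have "x0 \<in> supp \<alpha>" "x0 \<notin> supp ?\<alpha>" using s(2) by (auto simp: supp_def)
    moreover have "supp ?\<alpha> \<subseteq> supp \<alpha>" by (auto simp: supp_def \<mu>_def T_def split: if_splits)
    ultimately have "supp ?\<alpha> \<subset> supp \<alpha>" by blast
    then have "card (supp ?\<alpha>) < card (supp \<alpha>)"
      using T by (intro psubset_card_mono) (auto simp: T_def)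
    then have "\<not> Sol ?\<alpha>" using minimal by force
    moreover have "(\<Sum>x\<in>A. ?\<alpha> x *\<^sub>R w (\<sigma> x) x) = 0"
    proof -
      have "(\<Sum>x\<in>A. \<mu> x *\<^sub>R w (\<sigma> x) x) = 0" unfolding dependence_iff \<mu>_block by simp
      moreover have "(\<Sum>x\<in>A. ?\<alpha> x *\<^sub>R w (\<sigma> x) x)
          = (\<Sum>x\<in>A. \<alpha> x *\<^sub>R w (\<sigma> x) x) - s *\<^sub>R (\<Sum>x\<in>A. \<mu> x *\<^sub>R w (\<sigma> x) x)"
        by (simp add: scaleR_diff_left sum_subtractf scaleR_sum_right)
      ultimately show ?thesis using sol by (simp add: Sol_def)
    qed
    moreover have "\<forall>x\<in>A. 0 \<le> ?\<alpha> x * \<epsilon> x" using s(1) by (simp add: algebra_simps)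
    \<comment> \<open>Signs and dependence survive, so only nontriviality in \<open>Sol\<close> can
      fail.\<close>
    ultimately have "\<forall>x\<in>A. \<alpha> x = s * \<mu> x" unfolding Sol_def by auto
    then have "sum \<alpha> (b r) = s * sum \<mu> (b r)"
      unfolding sum_distrib_left by (intro sum.cong) (auto simp: b_def)
    also have "sum \<mu> (b r) = 0" using arg_cong[OF \<mu>_block[of r], of snd] by (simp add: snd_sum)
    finally show False using sum_pos[OF sol] by simp
  qed
  note block_card = this
  \<comment> \<open>A support of fewer than \<open>card A\<close> points has independent tensors,
    forcing \<open>\<alpha> = 0\<close> on its own support.\<close>
  have "\<not> card T \<le> (r - 1) * (CARD('n) + 1)"
  proof
    assume "card T \<le> (r - 1) * (CARD('n) + 1)"
    moreover have "(\<Sum>x\<in>T. \<alpha> x *\<^sub>R sarkaria_tensor r (\<sigma> x) (x, 1 :: real)) = (\<Sum>x\<in>A. \<alpha> x *\<^sub>R w (\<sigma> x) x)"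
      unfolding w_def by (rule sum.mono_neutral_left) (use T assms(2) in \<open>auto simp: T_def supp_def\<close>)
    ultimately have "\<forall>x\<in>T. \<alpha> x = 0"
      using sol T \<sigma> block_card
      by (intro sarkaria_tensor_independent_generic[OF assms(4) T r1]) (auto simp: Sol_def)
    then show False using sol by (auto simp: Sol_def T_def supp_def)
  qed
  then have "T = A" using T assms(2,3) card_mono[OF assms(2) T(1)] by (intro card_subset_eq) auto
  then have nonzero: "\<alpha> x \<noteq> 0" if "x \<in> A" for x using that by (auto simp: T_def supp_def)
  \<comment> \<open>Division by the positive common block sum normalizes it to 1 and keeps all
    signs, which are now strict.\<close>
  define t where "t = sum \<alpha> (b r)"
  have t: "t > 0" using sum_pos[OF sol] by (simp add: t_def)
  have one: "(\<Sum>x\<in>b j. \<alpha> x / t) = 1" if "j \<in> {1..r}" for j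
    using eq_sum[OF sol that] t by (simp add: sum_divide_distrib[symmetric] t_def)
  have z: "(\<Sum>x\<in>b j. (\<alpha> x / t) *\<^sub>R x) = (1 / t) *\<^sub>R (\<Sum>x\<in>b r. \<alpha> x *\<^sub>R x)" if "j \<in> {1..r}" for j
    unfolding eq_vec[OF sol that, symmetric] by (simp add: scaleR_sum_right)
  have neg_iff: "\<alpha> x / t < 0 \<longleftrightarrow> x \<in> M" if "x \<in> A" for x
    using sign[OF that] nonzero[OF that] t by (auto simp: \<epsilon>_def divide_less_0_iff split: if_splits)
  \<comment> \<open>An empty block would have coefficient sum 0 rather than 1.\<close>
  have "b j \<noteq> {}" if "j \<in> {1..r}" for j using one[OF that] by auto
  moreover have "disjoint_family_on b {1..r}" by (auto simp: disjoint_family_on_def b_def)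
  moreover have "(\<Union>j\<in>{1..r}. b j) = A" using \<sigma> by (auto simp: b_def)
  ultimately show ?thesis
    using one z neg_iff
    by (intro exI[of _ b] conjI exI[of _ "(1 / t) *\<^sub>R (\<Sum>x\<in>b r. \<alpha> x *\<^sub>R x)"] exI[of _ "\<lambda>x. \<alpha> x / t"]) auto
qed

end
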